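(* For any positive integers $k_1,k_2,\dots,k_l$ with some $k_i\ge 2$, $$\sum_{j=1}^l \zeta(k_j+1,k_{j+1},\dots,k_l,k_1,\dots,k_{j-1})=\sum_{\{j\,|\,k_j\ge 2\}}\ \sum_{q=0}^{k_j-2}\zeta(k_j-q,k_{j+1},\dots,k_l,k_1,\dots,k_{j-1},q+1).$$
   Context: For positive integers $k_1,\dots,k_l$ with $k_1>1$, the multiple zeta value is the sum of the convergent series $$\zeta(k_1,k_2,\dots,k_l)=\sum_{n_1>n_2>\cdots>n_l\ge 1}\frac{1}{n_1^{k_1}n_2^{k_2}\cdots n_l^{k_l}},$$ the sum being over integers. In the claim, $j$ ranges over $1,\dots,l$, and $k_j,k_{j+1},\dots,k_l,k_1,\dots,k_{j-1}$ is the cyclic permutation of the sequence starting at position $j$ (for $j=1$ the block $k_1,\dots,k_{j-1}$ is empty; for $j=l$ the block $k_{j+1},\dots,k_l$ is empty). *)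

theory Defs
  imports "HOL-Analysis.Analysis"
begin

definition mzv_index :: "nat \<Rightarrow> nat list set" where
  "mzv_index l = {ns. length ns = l \<and> sorted_wrt (>) ns \<and> (\<forall>n\<in>set ns. n \<ge> 1)}"

(* All terms are nonnegative, so summation over the unordered index set is the
   usual sum of the series. The value is meaningful only when the series
   converges, which for a nonempty list of positive exponents means that the
   leading exponent is at least 2; otherwise infsum is 0 by convention. *)
definition mzv :: "nat list \<Rightarrow> real" where
  "mzv ks = (\<Sum>\<^sub>\<infinity>ns\<in>mzv_index (length ks). 1 / (\<Prod>i<length ks. real (ns ! i) ^ (ks ! i)))"

end

theory Submission
  imports Defs "HOL-Real_Asymp.Real_Asymp"
begin

text \<open>
  The proof is the cyclic telescoping argument of Hoffman and Ohno. To an exponent list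
  \<open>k\<^sub>1, \<dots>, k\<^sub>l\<close> attach the series
  \<open>T(k\<^sub>1, \<dots>, k\<^sub>l) = \<Sum> 1 / ((n\<^sub>1 - j) n\<^sub>1^k\<^sub>1 \<cdots> n\<^sub>l^k\<^sub>l)\<close>, summed over all
  \<open>n\<^sub>1 > \<cdots> > n\<^sub>l > j \<ge> 0\<close>.
  Its part with \<open>j = 0\<close> is \<open>\<zeta>(k\<^sub>1 + 1, k\<^sub>2, \<dots>, k\<^sub>l)\<close>. In the part with \<open>j = m \<ge> 1\<close>, the
  powers of \<open>n\<^sub>1\<close> are traded for powers of \<open>m\<close> by partial fractions; each trade splits off one
  \<open>\<zeta>(k\<^sub>1 - q, k\<^sub>2, \<dots>, k\<^sub>l, q + 1)\<close>, until only a single factor \<open>n\<^sub>1 (n\<^sub>1 - m)\<close> is left. The sum of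
  \<open>1 / (n\<^sub>1 - m) - 1 / n\<^sub>1\<close> over all \<open>n\<^sub>1 > n\<^sub>2\<close> (where \<open>n\<^sub>2\<close> is \<open>m\<close> itself if \<open>l = 1\<close>) collapses to the \<open>m\<close> terms
  \<open>1 / (n\<^sub>2 - j)\<close>, \<open>0 \<le> j < m\<close>, and what results is
  \<open>T(k\<^sub>2, \<dots>, k\<^sub>l, k\<^sub>1)\<close>. Hence \<open>T(k\<^sub>1, \<dots>, k\<^sub>l) - T(k\<^sub>2, \<dots>, k\<^sub>l, k\<^sub>1)\<close> is
  \<open>\<zeta>(k\<^sub>1 + 1, k\<^sub>2, \<dots>, k\<^sub>l)\<close> minus the zeta values split off (\<open>gap_sum_rotate1\<close>), and adding this
  up over all rotations cancels every \<open>T\<close>.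

  The cancellation needs every \<open>T\<close> to be finite. All terms are nonnegative, so the same step shows
  that convergence of \<open>T\<close> at a rotation implies convergence one rotation earlier. It therefore
  suffices to bound \<open>T\<close> directly at the rotation that starts with an exponent \<open>k\<^sub>i \<ge> 2\<close>
  (\<open>gap_summable_leading\<close>), and to go backwards around the cycle from there
  (\<open>gap_summable_any_rotation\<close>).
\<close>

section \<open>Monomials and index lists\<close>

definition mzv_term :: "nat list \<Rightarrow> nat list \<Rightarrow> real" where
  "mzv_term ks ns = 1 / (\<Prod>i<length ks. real (ns ! i) ^ (ks ! i))"

text \<open>The inner sum over \<open>j\<close> in the series \<open>T\<close>; it depends on the largest and the smallest
  entry alone, so that \<open>T\<close> becomes a weighted sum over the index set of a multiple zeta value.\<close>

definition gap :: "nat list \<Rightarrow> real" where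
  "gap ns = (\<Sum>j<last ns. 1 / (real (hd ns) - real j))"

definition gap_summable :: "nat list \<Rightarrow> bool" where
  "gap_summable ks \<longleftrightarrow> (\<lambda>ns. gap ns * mzv_term ks ns) summable_on mzv_index (length ks)"

text \<open>This is \<open>T(k\<^sub>1, \<dots>, k\<^sub>l)\<close>.\<close>

definition gap_sum :: "nat list \<Rightarrow> real" where
  "gap_sum ks = (\<Sum>\<^sub>\<infinity>ns\<in>mzv_index (length ks). gap ns * mzv_term ks ns)"

lemma mzv_eq_infsum_term: "mzv ks = (\<Sum>\<^sub>\<infinity>ns\<in>mzv_index (length ks). mzv_term ks ns)"
  by (simp add: mzv_def mzv_term_def)

lemma mzv_term_nonneg: "mzv_term ks ns \<ge> 0"
  by (simp add: mzv_term_def prod_nonneg)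

lemma mzv_term_Nil [simp]: "mzv_term [] ns = 1"
  by (simp add: mzv_term_def)

lemma mzv_term_Cons [simp]: "mzv_term (k # ks) (n # ns) = 1 / real n ^ k * mzv_term ks ns"
  by (simp add: mzv_term_def prod.lessThan_Suc_shift del: prod.lessThan_Suc)

lemma mzv_term_snoc [simp]:
  assumes "length ns = length ks"
  shows "mzv_term (ks @ [k]) (ns @ [n]) = mzv_term ks ns * (1 / real n ^ k)"
proof -
  have "(\<Prod>i<length ks. real ((ns @ [n]) ! i) ^ ((ks @ [k]) ! i)) = (\<Prod>i<length ks. real (ns ! i) ^ (ks ! i))"
    using assms by (intro prod.cong) (auto simp: nth_append)
  then show ?thesis using assms by (simp add: mzv_term_def nth_append)
qed

lemma mzv_index_Cons_iff:
  "n # ns \<in> mzv_index (Suc l) \<longleftrightarrow> n \<ge> 1 \<and> (\<forall>m\<in>set ns. m < n) \<and> ns \<in> mzv_index l"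
  by (auto simp: mzv_index_def)

lemma mzv_index_snoc_iff:
  "ns @ [m] \<in> mzv_index (Suc l) \<longleftrightarrow> m \<ge> 1 \<and> (\<forall>n\<in>set ns. m < n) \<and> ns \<in> mzv_index l"
  by (auto simp: mzv_index_def sorted_wrt_append)

lemma mzv_index_hd_last:
  assumes "ns \<in> mzv_index l" "l \<ge> 1"
  shows "ns \<noteq> []" "1 \<le> last ns" "n \<in> set ns \<Longrightarrow> n \<le> hd ns" "n \<in> set ns \<Longrightarrow> last ns \<le> n"
proof -
  show ne: "ns \<noteq> []" using assms by (auto simp: mzv_index_def)
  show "1 \<le> last ns" using assms ne by (auto simp: mzv_index_def)
  show "n \<in> set ns \<Longrightarrow> n \<le> hd ns"
    using assms ne by (cases ns) (auto simp: mzv_index_def)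
  show "n \<in> set ns \<Longrightarrow> last ns \<le> n"
    using assms ne by (cases ns rule: rev_cases) (auto simp: mzv_index_def sorted_wrt_append)
qed

lemma gap_nonneg:
  assumes "ns \<in> mzv_index l" "l \<ge> 1"
  shows "gap ns \<ge> 0"
  unfolding gap_def
  using mzv_index_hd_last(1)[OF assms] mzv_index_hd_last(3)[OF assms, of "last ns"]
  by (intro sum_nonneg) auto

text \<open>The next two decompositions are the two ways of summing over chains of length \<open>l + 1\<close>:
  smallest entry innermost, which gives \<open>T\<close> for the original list, or largest entry innermost, which
  gives \<open>T\<close> for the rotated list.\<close>

lemma bij_betw_mzv_index_snoc:
  assumes "l \<ge> 1"
  shows "bij_betw (\<lambda>(ns, m). ns @ [m]) (SIGMA ns:mzv_index l. {1..<last ns}) (mzv_index (Suc l))"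
proof (rule bij_betw_byWitness[where f' = "\<lambda>xs. (butlast xs, last xs)"])
  show "(\<lambda>(ns, m). ns @ [m]) ` (SIGMA ns:mzv_index l. {1..<last ns}) \<subseteq> mzv_index (Suc l)"
    using mzv_index_hd_last(4)[OF _ assms] by (fastforce simp: mzv_index_snoc_iff)
  show "(\<lambda>xs. (butlast xs, last xs)) ` mzv_index (Suc l) \<subseteq> (SIGMA ns:mzv_index l. {1..<last ns})"
  proof (intro image_subsetI)
    fix xs assume xs: "xs \<in> mzv_index (Suc l)"
    then obtain ns m where e: "xs = ns @ [m]"
      by (cases xs rule: rev_cases) (auto simp: mzv_index_def)
    with xs have "ns \<in> mzv_index l" "m \<ge> 1" "\<forall>n\<in>set ns. m < n" by (auto simp: mzv_index_snoc_iff)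
    moreover from this have "ns \<noteq> []" using mzv_index_hd_last assms by blast
    ultimately show "(butlast xs, last xs) \<in> (SIGMA ns:mzv_index l. {1..<last ns})"
      by (auto simp: e)
  qed
qed (auto simp: mzv_index_def length_Suc_conv_rev)

lemma bij_betw_mzv_index_Cons:
  assumes "l \<ge> 1"
  shows "bij_betw (\<lambda>(ns, n). n # ns) (SIGMA ns:mzv_index l. {hd ns<..}) (mzv_index (Suc l))"
proof (rule bij_betw_byWitness[where f' = "\<lambda>xs. (tl xs, hd xs)"])
  show "(\<lambda>(ns, n). n # ns) ` (SIGMA ns:mzv_index l. {hd ns<..}) \<subseteq> mzv_index (Suc l)"
    using mzv_index_hd_last(3)[OF _ assms] by (fastforce simp: mzv_index_Cons_iff)
  show "(\<lambda>xs. (tl xs, hd xs)) ` mzv_index (Suc l) \<subseteq> (SIGMA ns:mzv_index l. {hd ns<..})"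
  proof (intro image_subsetI)
    fix xs assume xs: "xs \<in> mzv_index (Suc l)"
    then obtain n ns where e: "xs = n # ns"
      by (cases xs) (auto simp: mzv_index_def)
    with xs have "ns \<in> mzv_index l" "\<forall>m\<in>set ns. m < n" by (auto simp: mzv_index_Cons_iff)
    moreover from this have "ns \<noteq> []" using mzv_index_hd_last assms by blast
    ultimately show "(tl xs, hd xs) \<in> (SIGMA ns:mzv_index l. {hd ns<..})"
      by (auto simp: e)
  qed
qed (auto simp: mzv_index_def length_Suc_conv)

section \<open>One cyclic step\<close>

lemma has_sum_sum_finite:
  fixes f :: "'i \<Rightarrow> 'a \<Rightarrow> real"
  assumes "finite I" "\<And>i. i \<in> I \<Longrightarrow> (f i has_sum c i) A"
  shows "((\<lambda>x. \<Sum>i\<in>I. f i x) has_sum (\<Sum>i\<in>I. c i)) A"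
  using assms by (induction I rule: finite_induct) (auto intro!: has_sum_add)

text \<open>Iterate \<open>1 / (n (n - m)) = (1 / m) (1 / (n - m) - 1 / n)\<close>: each use lowers the exponent of \<open>n\<close>
  by one, raises that of \<open>m\<close> by one, and leaves one term without the factor \<open>n - m\<close>. The iteration
  stops at exponent one of \<open>n\<close>, so that exactly the convergent zeta values are split off.\<close>

lemma partial_fractions:
  fixes n m :: real
  assumes "k \<ge> 1" "m > 0" "n > m"
  shows "1 / ((n - m) * n ^ k) + (\<Sum>q<k - 1. 1 / (n ^ (k - q) * m ^ (q + 1)))
       = m / ((n - m) * n * m ^ k)"
  using assms(1)
proof (induction k rule: nat_induct_at_least)
  case base
  then show ?case using assms by simp
next
  case (Suc k)
  then obtain j where k: "k = Suc j" by (cases k) auto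
  let ?s = "\<Sum>q<k - 1. 1 / (n ^ (k - q) * m ^ (q + 1))"
  have "(\<Sum>q<k. 1 / (n ^ (Suc k - q) * m ^ (q + 1)))
      = 1 / (n ^ Suc k * m) + (\<Sum>q<k - 1. 1 / (n ^ (k - q) * m ^ (q + 2)))"
    by (simp add: k sum.lessThan_Suc_shift del: sum.lessThan_Suc power_Suc)
  also have "(\<Sum>q<k - 1. 1 / (n ^ (k - q) * m ^ (q + 2))) = ?s / m"
    by (simp add: sum_divide_distrib mult_ac)
  finally have "1 / ((n - m) * n ^ Suc k) + (\<Sum>q<k. 1 / (n ^ (Suc k - q) * m ^ (q + 1)))
     = (1 / ((n - m) * n ^ Suc k) + 1 / (n ^ Suc k * m)) + ?s / m" by simp
  also have "1 / ((n - m) * n ^ Suc k) + 1 / (n ^ Suc k * m) = 1 / ((n - m) * n ^ k) / m"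
    using assms by (simp add: field_simps)
  also have "1 / ((n - m) * n ^ k) / m + ?s / m = (1 / ((n - m) * n ^ k) + ?s) / m"
    by (simp add: add_divide_distrib)
  also have "\<dots> = m / ((n - m) * n * m ^ Suc k)"
    unfolding Suc.IH by simp
  finally show ?case by simp
qed

text \<open>The summand is \<open>1 / (n - m) - 1 / n\<close>, a difference of two copies of the harmonic series shifted
  by \<open>m\<close>; only the first \<open>m\<close> terms of the earlier copy survive.\<close>

lemma has_sum_shifted_differences:
  fixes m a :: nat
  assumes "0 < m" "m \<le> a"
  shows "((\<lambda>n. real m / ((real n - real m) * real n)) has_sum (\<Sum>j<m. 1 / (real a - real j))) {a<..}"
proof -
  \<comment> \<open>A window of \<open>m\<close> consecutive terms of the harmonic series: moving it by one step changes it by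
    the summand.\<close>
  define v where "v i = (\<Sum>j<m. 1 / (real (i + j) + (real a + 1 - real m)))" for i
  define f where "f n = real m / ((real n - real m) * real n)" for n
  have f_diff: "f (a + 1 + i) = v i - v (Suc i)" for i
  proof -
    have p: "real (i + j) + (real a + 1 - real m) > 0" for j using assms by auto
    have "v i - v (Suc i) = - (\<Sum>j<m. 1 / (real (i + Suc j) + (real a + 1 - real m)) - 1 / (real (i + j) + (real a + 1 - real m)))"
      by (simp add: v_def sum_subtractf)
    also have "\<dots> = 1 / (real i + (real a + 1 - real m)) - 1 / (real (i + m) + (real a + 1 - real m))"
      by (subst sum_lessThan_telescope) simp
    also have "\<dots> = f (a + 1 + i)"
      using p[of 0] p[of m] by (simp add: f_def field_simps)
    finally show ?thesis by simp
  qed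
  have "v \<longlonglongrightarrow> (\<Sum>j<m. 0)"
    unfolding v_def
  proof (intro tendsto_sum)
    fix j
    have "(\<lambda>i. 1 / (real (i + j) + (real a + 1 - real m))) = (\<lambda>i. 1 / (real i + (real j + (real a + 1 - real m))))"
      by (simp add: add_ac)
    then show "(\<lambda>i. 1 / (real (i + j) + (real a + 1 - real m))) \<longlonglongrightarrow> 0"
      by (simp only:) real_asymp
  qed
  then have v0: "v \<longlonglongrightarrow> 0" by simp
  have s: "(\<lambda>i. f (a + 1 + i)) sums v 0"
    using telescope_sums'[OF v0] unfolding f_diff by simp
  have nn: "f (a + 1 + i) \<ge> 0" for i using assms by (simp add: f_def)
  have "((\<lambda>i. f (a + 1 + i)) has_sum v 0) UNIV"
    using s nn by (intro norm_summable_imp_has_sum) (auto simp: sums_iff)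
  moreover have "bij_betw (\<lambda>i. a + 1 + i) UNIV {a<..}"
    by (rule bij_betw_byWitness[where f' = "\<lambda>n. n - (a + 1)"]) auto
  ultimately have "(f has_sum v 0) {a<..}"
    using has_sum_reindex_bij_betw[of "\<lambda>i. a + 1 + i" UNIV "{a<..}" f "v 0"] by simp
  moreover have "v 0 = (\<Sum>j<m. 1 / (real a - real j))"
    unfolding v_def using assms
    by (subst sum.nat_diff_reindex[symmetric]) (auto intro!: sum.cong simp: of_nat_diff)
  ultimately show ?thesis unfolding f_def [abs_def] by simp
qed

text \<open>The engine of the proof. Convergence is inferred from the rotated list to the original one,
  because there the summand \<open>S'\<close> dominates the nonnegative pieces \<open>S\<close> and \<open>Z q\<close> into which partial
  fractions split it.\<close>

lemma gap_sum_rotate1: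
  assumes k: "k \<ge> 1"
    and cs: "gap_summable (r @ [k])"
    and ms: "mzv_term ((k + 1) # r) summable_on mzv_index (Suc (length r))"
  shows "gap_summable (k # r)"
    and "gap_sum (k # r) + (\<Sum>q<k - 1. mzv ((k - q) # r @ [q + 1])) = gap_sum (r @ [k]) + mzv ((k + 1) # r)"
proof -
  define l where "l = Suc (length r)"
  have l1: "l \<ge> 1" by (simp add: l_def)
  \<comment> \<open>Both are functions on chains of length \<open>l + 1\<close>: \<open>S\<close> is the summand of \<open>T(k # r)\<close> with \<open>j\<close> as
    the last entry, \<open>S'\<close> that of \<open>T(r @ [k])\<close> before the largest entry is summed out.\<close>
  define S where "S xs = 1 / (real (hd xs) - real (last xs)) * mzv_term (k # r) (butlast xs)" for xs
  define S' where "S' xs = real (last xs) / ((real (hd xs) - real (last xs)) * real (hd xs)) * mzv_term (r @ [k]) (tl xs)" for xs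
  define Z where "Z q = mzv_term ((k - q) # r @ [q + 1])" for q
  have split: "S xs + (\<Sum>q<k - 1. Z q xs) = S' xs"
    and S_nn: "S xs \<ge> 0" if xs: "xs \<in> mzv_index (Suc l)" for xs
  proof -
    obtain n ys where "xs = n # ys" using xs by (cases xs) (auto simp: mzv_index_def)
    moreover obtain mid m where "ys = mid @ [m]"
      using xs calculation by (cases ys rule: rev_cases) (auto simp: mzv_index_def l_def)
    ultimately have e: "xs = n # mid @ [m]" by simp
    have len: "length mid = length r" using xs by (simp add: e mzv_index_def l_def)
    have nm: "m > 0" "n > m" using xs by (auto simp: e mzv_index_def)
    have b: "butlast xs = n # mid" by (simp add: e butlast_append)
    have "S xs + (\<Sum>q<k - 1. Z q xs) =
       mzv_term r mid * (1 / ((real n - real m) * real n ^ k) + (\<Sum>q<k - 1. 1 / (real n ^ (k - q) * real m ^ (q + 1))))"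
      using len unfolding S_def Z_def b by (simp add: e distrib_left sum_distrib_left mult_ac)
    also have "\<dots> = S' xs"
      using nm k len by (subst partial_fractions) (auto simp: S'_def e)
    finally show "S xs + (\<Sum>q<k - 1. Z q xs) = S' xs" .
    show "S xs \<ge> 0" unfolding S_def using nm by (intro mult_nonneg_nonneg mzv_term_nonneg) (auto simp: e)
  qed
  have Z_nn: "Z q xs \<ge> 0" for q xs by (simp add: Z_def mzv_term_nonneg)

  have inner': "((\<lambda>n. S' (n # ns)) has_sum gap ns * mzv_term (r @ [k]) ns) {hd ns<..}"
    if ns: "ns \<in> mzv_index l" for ns
  proof -
    note h = mzv_index_hd_last[OF ns l1]
    have "((\<lambda>n. real (last ns) / ((real n - real (last ns)) * real n)) has_sum gap ns) {hd ns<..}"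
      unfolding gap_def using h by (intro has_sum_shifted_differences) auto
    from has_sum_cmult_left[OF this, of "mzv_term (r @ [k]) ns"] show ?thesis
      using h(1) by (simp add: S'_def)
  qed
  have outer': "((\<lambda>ns. gap ns * mzv_term (r @ [k]) ns) has_sum gap_sum (r @ [k])) (mzv_index l)"
    using cs unfolding gap_summable_def gap_sum_def by (simp add: l_def)
  have "(\<lambda>(ns, n). S' (n # ns)) summable_on (SIGMA ns:mzv_index l. {hd ns<..})"
  proof (rule summable_on_SigmaI)
    show "((\<lambda>n. case (ns, n) of (ns, n) \<Rightarrow> S' (n # ns)) has_sum gap ns * mzv_term (r @ [k]) ns) {hd ns<..}"
      if "ns \<in> mzv_index l" for ns using inner'[OF that] by simp
    show "(\<lambda>ns. gap ns * mzv_term (r @ [k]) ns) summable_on mzv_index l"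
      using outer' by (rule has_sum_imp_summable)
  next
    fix ns n assume a: "ns \<in> mzv_index l" "n \<in> {hd ns<..}"
    then have "n # ns \<in> mzv_index (Suc l)"
      using bij_betw_mzv_index_Cons[OF l1] by (force simp: bij_betw_def)
    then have "S' (n # ns) \<ge> 0" using split S_nn Z_nn by (metis add_nonneg_nonneg sum_nonneg)
    then show "(case (ns, n) of (ns, n) \<Rightarrow> S' (n # ns)) \<ge> 0" by simp
  qed
  then have "((\<lambda>(ns, n). S' (n # ns)) has_sum gap_sum (r @ [k])) (SIGMA ns:mzv_index l. {hd ns<..})"
    using inner' outer' by (intro has_sum_SigmaI[where g = "\<lambda>ns. gap ns * mzv_term (r @ [k]) ns"]) auto
  then have S'_sum: "(S' has_sum gap_sum (r @ [k])) (mzv_index (Suc l))"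
    using has_sum_reindex_bij_betw[OF bij_betw_mzv_index_Cons[OF l1], of S']
    by (simp add: case_prod_unfold)

  have S_summable: "S summable_on mzv_index (Suc l)"
  proof (rule summable_on_comparison_test[OF has_sum_imp_summable[OF S'_sum]])
    fix xs assume "xs \<in> mzv_index (Suc l)"
    then show "S xs \<le> S' xs" "0 \<le> S xs"
      using split[of xs] S_nn[of xs] sum_nonneg[of "{..<k - 1}" "\<lambda>q. Z q xs"] Z_nn by auto
  qed
  have Z_summable: "Z q summable_on mzv_index (Suc l)" if "q < k - 1" for q
  proof (rule summable_on_comparison_test[OF has_sum_imp_summable[OF S'_sum]])
    fix xs assume "xs \<in> mzv_index (Suc l)"
    moreover have "Z q xs \<le> (\<Sum>q<k - 1. Z q xs)" using that Z_nn by (intro member_le_sum) auto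
    ultimately show "Z q xs \<le> S' xs" "0 \<le> Z q xs"
      using split[of xs] S_nn[of xs] Z_nn by auto
  qed
  have Z_sum: "(Z q has_sum mzv ((k - q) # r @ [q + 1])) (mzv_index (Suc l))" if "q < k - 1" for q
    using has_sum_infsum[OF Z_summable[OF that]] by (simp add: mzv_eq_infsum_term Z_def l_def)
  let ?zs = "\<Sum>q<k - 1. mzv ((k - q) # r @ [q + 1])"
  have "((\<lambda>xs. S xs + (\<Sum>q<k - 1. Z q xs)) has_sum (infsum S (mzv_index (Suc l)) + ?zs)) (mzv_index (Suc l))"
    using Z_sum by (intro has_sum_add has_sum_infsum S_summable has_sum_sum_finite) auto
  then have "(S' has_sum (infsum S (mzv_index (Suc l)) + ?zs)) (mzv_index (Suc l))"
    using split by (simp cong: has_sum_cong)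
  then have S_eq: "infsum S (mzv_index (Suc l)) + ?zs = gap_sum (r @ [k])"
    using S'_sum has_sum_unique by blast

  \<comment> \<open>Chains have positive entries, so summing \<open>S\<close> over the last entry misses the term \<open>j = 0\<close> of
    \<open>gap\<close>; this term makes up \<open>\<zeta>(k + 1, r)\<close>.\<close>
  have inner: "((\<lambda>m. S (ns @ [m])) has_sum (gap ns - 1 / real (hd ns)) * mzv_term (k # r) ns) {1..<last ns}"
    if ns: "ns \<in> mzv_index l" for ns
  proof -
    note h = mzv_index_hd_last[OF ns l1]
    have "{..<last ns} = insert 0 {1..<last ns}" using h by auto
    then have "gap ns = 1 / real (hd ns) + (\<Sum>m\<in>{1..<last ns}. 1 / (real (hd ns) - real m))"
      by (simp add: gap_def)
    then have "(\<Sum>m\<in>{1..<last ns}. S (ns @ [m])) = (gap ns - 1 / real (hd ns)) * mzv_term (k # r) ns"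
      using h(1) by (simp add: S_def sum_distrib_right)
    then show ?thesis by (intro has_sum_finiteI) auto
  qed
  have "((\<lambda>(ns, m). S (ns @ [m])) has_sum infsum S (mzv_index (Suc l))) (SIGMA ns:mzv_index l. {1..<last ns})"
    using has_sum_reindex_bij_betw[OF bij_betw_mzv_index_snoc[OF l1], of S] S_summable
    by (simp add: case_prod_unfold)
  then have "((\<lambda>ns. (gap ns - 1 / real (hd ns)) * mzv_term (k # r) ns) has_sum infsum S (mzv_index (Suc l))) (mzv_index l)"
    by (rule has_sum_SigmaD) (use inner in simp)
  moreover have "(mzv_term ((k + 1) # r) has_sum mzv ((k + 1) # r)) (mzv_index l)"
    using has_sum_infsum[OF ms] by (simp add: mzv_eq_infsum_term l_def)
  ultimately have "((\<lambda>ns. (gap ns - 1 / real (hd ns)) * mzv_term (k # r) ns + mzv_term ((k + 1) # r) ns)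
      has_sum (infsum S (mzv_index (Suc l)) + mzv ((k + 1) # r))) (mzv_index l)"
    by (rule has_sum_add)
  moreover have "(gap ns - 1 / real (hd ns)) * mzv_term (k # r) ns + mzv_term ((k + 1) # r) ns = gap ns * mzv_term (k # r) ns"
    if "ns \<in> mzv_index l" for ns
    using mzv_index_hd_last(1)[OF that l1] by (cases ns) (auto simp: algebra_simps)
  ultimately have *: "((\<lambda>ns. gap ns * mzv_term (k # r) ns)
      has_sum (infsum S (mzv_index (Suc l)) + mzv ((k + 1) # r))) (mzv_index l)"
    by (simp cong: has_sum_cong)
  show "gap_summable (k # r)"
    using has_sum_imp_summable[OF *] by (simp add: gap_summable_def l_def)
  have "gap_sum (k # r) = infsum S (mzv_index (Suc l)) + mzv ((k + 1) # r)"
    using infsumI[OF *] by (simp add: gap_sum_def l_def)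
  then show "gap_sum (k # r) + ?zs = gap_sum (r @ [k]) + mzv ((k + 1) # r)"
    using S_eq by simp
qed

section \<open>Convergence\<close>

lemma summable_on_prod_list:
  fixes g :: "'a \<Rightarrow> real"
  assumes "g summable_on A" "\<And>x. x \<in> A \<Longrightarrow> g x \<ge> 0"
  shows "(\<lambda>xs. prod_list (map g xs)) summable_on {xs. length xs = l \<and> set xs \<subseteq> A}"
proof (induction l)
  case 0
  have "{xs. length xs = 0 \<and> set xs \<subseteq> A} = {[]}" by auto
  then show ?case by simp
next
  case (Suc l)
  let ?L = "\<lambda>l. {xs. length xs = l \<and> set xs \<subseteq> A}"
  have b: "bij_betw (\<lambda>(x, xs). x # xs) (A \<times> ?L l) (?L (Suc l))"
    by (rule bij_betw_byWitness[where f' = "\<lambda>xs. (hd xs, tl xs)"]) (auto simp: length_Suc_conv)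
  have "(\<lambda>(x, xs). g x * prod_list (map g xs)) summable_on (A \<times> ?L l)"
  proof (rule summable_on_SigmaI)
    show "((\<lambda>xs. case (x, xs) of (x, xs) \<Rightarrow> g x * prod_list (map g xs))
        has_sum g x * (\<Sum>\<^sub>\<infinity>xs\<in>?L l. prod_list (map g xs))) (?L l)" for x
      using has_sum_cmult_right[OF has_sum_infsum[OF Suc.IH]] by simp
    show "(\<lambda>x. g x * (\<Sum>\<^sub>\<infinity>xs\<in>?L l. prod_list (map g xs))) summable_on A"
      using assms(1) by (rule summable_on_cmult_left)
    fix x xs assume "x \<in> A" "xs \<in> ?L l"
    moreover have "prod_list (map g xs) \<ge> 0" if "set xs \<subseteq> A" for xs
      using that assms(2) by (induction xs) auto
    ultimately show "(case (x, xs) of (x, xs) \<Rightarrow> g x * prod_list (map g xs)) \<ge> 0"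
      using assms(2) by auto
  qed
  then show ?case
    using summable_on_reindex_bij_betw[OF b, of "\<lambda>xs. prod_list (map g xs)"]
    by (simp add: case_prod_unfold)
qed

lemma powr_neg_one_plus:
  assumes "n \<ge> 1"
  shows "real n powr - (1 + \<delta>) = real n powr - \<delta> * (1 / real n)"
proof -
  have "- (1 + \<delta>) = - \<delta> - 1" by simp
  then show ?thesis using assms by (simp only: powr_diff) simp
qed

text \<open>Since \<open>1 / i \<le> n powr \<delta> * i powr - (1 + \<delta>)\<close> for \<open>i \<le> n\<close>, a convergent zeta series serves as
  the constant.\<close>

lemma harm_le_powr:
  fixes \<delta> :: real
  assumes "\<delta> > 0"
  shows "\<exists>C\<ge>0. \<forall>n\<ge>1. (\<Sum>i=1..n. 1 / real i) \<le> C * real n powr \<delta>"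
proof -
  define g where "g i = real i powr - (1 + \<delta>)" for i :: nat
  have g_nonneg: "g i \<ge> 0" for i by (simp add: g_def)
  have s: "summable g" unfolding g_def using assms by (subst summable_real_powr_iff) auto
  have "(\<Sum>i=1..n. 1 / real i) \<le> suminf g * real n powr \<delta>" for n
  proof -
    have "(\<Sum>i=1..n. 1 / real i) \<le> (\<Sum>i=1..n. g i * real n powr \<delta>)"
    proof (intro sum_mono)
      fix i assume i: "i \<in> {1..n}"
      then have "1 / real i = g i * real i powr \<delta>"
        unfolding g_def by (subst powr_neg_one_plus) (auto simp: powr_minus)
      also have "\<dots> \<le> g i * real n powr \<delta>"
        using i assms by (intro mult_left_mono powr_mono2) (auto simp: g_def)
      finally show "1 / real i \<le> g i * real n powr \<delta>" .
    qed
    also have "\<dots> = (\<Sum>i=1..n. g i) * real n powr \<delta>" by (simp add: sum_distrib_right)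
    also have "\<dots> \<le> suminf g * real n powr \<delta>"
      using s g_nonneg by (intro mult_right_mono sum_le_suminf) auto
    finally show ?thesis .
  qed
  moreover have "suminf g \<ge> 0" using s g_nonneg by (intro suminf_nonneg)
  ultimately show ?thesis by blast
qed

lemma mzv_term_le_prod_list:
  assumes "length ns = length ks" "\<forall>k\<in>set ks. k \<ge> 1" "\<forall>n\<in>set ns. n \<ge> 1"
  shows "mzv_term ks ns \<le> prod_list (map (\<lambda>n. 1 / real n) ns)"
  using assms
proof (induction ns ks rule: list_induct2)
  case Nil
  then show ?case by simp
next
  case (Cons n ns k ks)
  have "real n ^ 1 \<le> real n ^ k" using Cons.prems by (intro power_increasing) auto
  then have "1 / real n ^ k \<le> 1 / real n" using Cons.prems by (simp add: frac_le)
  moreover have "mzv_term ks ns \<le> prod_list (map (\<lambda>n. 1 / real n) ns)" using Cons by simp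
  ultimately show ?case
    using mzv_term_nonneg[of ks ns] by (simp only: mzv_term_Cons list.map prod_list.Cons) (intro mult_mono, auto)
qed

text \<open>A negative power of the largest entry can be distributed over the entries, which turns each
  divergent factor \<open>1 / n\<close> into a convergent one. This replaces the nested sum over chains by a product
  of independent series.\<close>

lemma powr_spread:
  fixes \<delta> :: real
  assumes "\<delta> > 0" "\<forall>n\<in>set ns. 1 \<le> n \<and> n \<le> a"
  shows "real a powr - (\<delta> * real (length ns)) * prod_list (map (\<lambda>n. 1 / real n) ns)
     \<le> prod_list (map (\<lambda>n. real n powr - (1 + \<delta>)) ns)"
  using assms(2)
proof (induction ns)
  case Nil
  then show ?case by simp
next
  case (Cons n ns)
  let ?P = "prod_list (map (\<lambda>n. 1 / real n) ns)"
  have P: "?P \<ge> 0" by (intro prod_list_nonneg) auto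
  have "real a powr - \<delta> \<le> real n powr - \<delta>"
    using Cons.prems assms(1) by (intro powr_mono2') auto
  then have "real a powr - \<delta> * (1 / real n) \<le> real n powr - \<delta> * (1 / real n)"
    by (intro mult_right_mono) auto
  also have "\<dots> = real n powr - (1 + \<delta>)"
    using Cons.prems by (subst powr_neg_one_plus) auto
  finally have "(real a powr - \<delta> * (1 / real n)) * (real a powr - (\<delta> * real (length ns)) * ?P)
     \<le> real n powr - (1 + \<delta>) * prod_list (map (\<lambda>n. real n powr - (1 + \<delta>)) ns)"
    using Cons P by (intro mult_mono) auto
  moreover have "real a powr - (\<delta> * real (length (n # ns))) = real a powr - \<delta> * real a powr - (\<delta> * real (length ns))"
    by (simp add: powr_add[symmetric] algebra_simps)
  ultimately show ?case by (simp add: mult_ac)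
qed

text \<open>A leading exponent at least two leaves one factor \<open>1 / n\<^sub>1\<close> to spare. It is cut into \<open>l + 1\<close>
  equal powers: one absorbs the harmonic number, the others go to the \<open>l\<close> entries.\<close>

lemma summable_on_harm_mzv_term:
  assumes "k \<ge> 2" "\<forall>k\<in>set r. k \<ge> 1"
  shows "(\<lambda>ns. (\<Sum>i=1..hd ns. 1 / real i) * mzv_term (k # r) ns) summable_on mzv_index (Suc (length r))"
proof -
  define l where "l = Suc (length r)"
  define \<delta> where "\<delta> = 1 / (real l + 1)"
  have d: "\<delta> > 0" "\<delta> * real l = 1 - \<delta>" by (auto simp: \<delta>_def l_def field_simps)
  obtain C where C: "C \<ge> 0" "\<And>n. n \<ge> 1 \<Longrightarrow> (\<Sum>i=1..n. 1 / real i) \<le> C * real n powr \<delta>"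
    using harm_le_powr[OF d(1)] by blast
  define g where "g n = real n powr - (1 + \<delta>)" for n :: nat
  have g_nonneg: "g n \<ge> 0" for n by (simp add: g_def)
  have "summable g" unfolding g_def using d by (subst summable_real_powr_iff) auto
  then have "g summable_on UNIV"
    using g_nonneg by (intro norm_summable_imp_summable_on) simp
  then have "(\<lambda>ns. prod_list (map g ns)) summable_on {ns. length ns = l \<and> set ns \<subseteq> UNIV}"
    by (rule summable_on_prod_list) (rule g_nonneg)
  then have "(\<lambda>ns. prod_list (map g ns)) summable_on mzv_index l"
    by (rule summable_on_subset_banach) (auto simp: mzv_index_def)
  then have "(\<lambda>ns. C * prod_list (map g ns)) summable_on mzv_index l"
    by (rule summable_on_cmult_right)
  then have "(\<lambda>ns. (\<Sum>i=1..hd ns. 1 / real i) * mzv_term (k # r) ns) summable_on mzv_index l"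
  proof (rule summable_on_comparison_test)
    fix ns assume ns: "ns \<in> mzv_index l"
    show "0 \<le> (\<Sum>i=1..hd ns. 1 / real i) * mzv_term (k # r) ns"
      by (intro mult_nonneg_nonneg mzv_term_nonneg sum_nonneg) auto
    obtain n ms where e: "ns = n # ms" using ns by (cases ns) (auto simp: mzv_index_def l_def)
    have n: "n \<ge> 1" and len: "length ms = length r" "length ns = l" and ms: "\<forall>m\<in>set ns. 1 \<le> m \<and> m \<le> n"
      using ns by (auto simp: e mzv_index_def l_def)
    let ?P = "prod_list (map (\<lambda>n. 1 / real n) ns)"
    have P: "?P \<ge> 0" by (intro prod_list_nonneg) auto
    have "mzv_term (k # r) ns = 1 / real n * mzv_term ((k - 1) # r) ns"
      using assms(1) n by (cases k) (auto simp: e)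
    also have "\<dots> \<le> 1 / real n * ?P"
      using assms ns n len ms by (intro mult_left_mono mzv_term_le_prod_list) (auto simp: l_def)
    finally have "(\<Sum>i=1..n. 1 / real i) * mzv_term (k # r) ns \<le> (C * real n powr \<delta>) * (1 / real n * ?P)"
      using C n P mzv_term_nonneg by (intro mult_mono) auto
    also have "\<dots> = C * (real n powr - (\<delta> * real (length ns)) * ?P)"
      using n by (simp add: d len powr_diff field_simps)
    also have "\<dots> \<le> C * prod_list (map g ns)"
      unfolding g_def using C(1) powr_spread[OF d(1) ms] by (rule mult_left_mono[rotated])
    finally show "(\<Sum>i=1..hd ns. 1 / real i) * mzv_term (k # r) ns \<le> C * prod_list (map g ns)"
      by (simp add: e)
  qed
  then show ?thesis by (simp add: l_def)
qed

lemma summable_on_mzv_term: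
  assumes "k \<ge> 2" "\<forall>k\<in>set r. k \<ge> 1"
  shows "mzv_term (k # r) summable_on mzv_index (Suc (length r))"
proof (rule summable_on_comparison_test[OF summable_on_harm_mzv_term[OF assms]])
  fix ns assume ns: "ns \<in> mzv_index (Suc (length r))"
  then have "hd ns \<ge> 1" by (cases ns) (auto simp: mzv_index_def)
  then have "(\<Sum>i=1..1. 1 / real i) \<le> (\<Sum>i=1..hd ns. 1 / real i)" by (intro sum_mono2) auto
  then show "mzv_term (k # r) ns \<le> (\<Sum>i=1..hd ns. 1 / real i) * mzv_term (k # r) ns"
    using mult_right_mono[OF _ mzv_term_nonneg, of 1] by fastforce
qed (rule mzv_term_nonneg)

lemma gap_summable_leading:
  assumes "k \<ge> 2" "\<forall>k\<in>set r. k \<ge> 1"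
  shows "gap_summable (k # r)"
  unfolding gap_summable_def length_Cons
proof (rule summable_on_comparison_test[OF summable_on_harm_mzv_term[OF assms]])
  fix ns assume ns: "ns \<in> mzv_index (Suc (length r))"
  note h = mzv_index_hd_last[OF ns]
  have "gap ns \<le> (\<Sum>j<hd ns. 1 / (real (hd ns) - real j))"
    unfolding gap_def using h(1) h(3)[of "last ns"] by (intro sum_mono2) auto
  also have "\<dots> = (\<Sum>i=1..hd ns. 1 / real i)"
    by (rule sum.reindex_bij_witness[where i = "\<lambda>i. hd ns - i" and j = "\<lambda>j. hd ns - j"])
       (auto simp: of_nat_diff)
  finally show "gap ns * mzv_term (k # r) ns \<le> (\<Sum>i=1..hd ns. 1 / real i) * mzv_term (k # r) ns"
    by (intro mult_right_mono mzv_term_nonneg)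
  show "0 \<le> gap ns * mzv_term (k # r) ns"
    using gap_nonneg[OF ns] mzv_term_nonneg by simp
qed

section \<open>The cyclic sum formula\<close>

text \<open>Convergence propagates from a rotation to the preceding one, so the starting point is a position
  \<open>i\<close> with a large exponent, moved by full turns until it lies beyond \<open>j\<close>.\<close>

lemma gap_summable_any_rotation:
  assumes pos: "\<forall>k\<in>set ks. k \<ge> 1" and big: "\<exists>k\<in>set ks. k \<ge> 2"
  shows "gap_summable (rotate j ks)"
proof -
  obtain i where i: "i < length ks" "ks ! i \<ge> 2" using big by (metis in_set_conv_nth)
  have ne: "rotate t ks \<noteq> []" for t using i by auto
  have down: "gap_summable (rotate t ks)" if "gap_summable (rotate (Suc t) ks)" for t
  proof -
    obtain k r where kr: "rotate t ks = k # r" using ne[of t] by (cases "rotate t ks") auto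
    then have "set (k # r) = set ks" by (metis set_rotate)
    with pos have p: "k \<ge> 1" "\<forall>k\<in>set r. k \<ge> 1" by auto
    have "gap_summable (r @ [k])" using that kr by simp
    from gap_sum_rotate1(1)[OF p(1) this] summable_on_mzv_term[of "k + 1" r] p show ?thesis
      by (simp add: kr)
  qed
  let ?N = "i + j * length ks"
  have "rotate ?N ks = rotate i ks"
    by (metis mod_mult_self1 mult.commute rotate_conv_mod)
  also have "\<dots> = ks ! i # drop (Suc i) ks @ take i ks"
    using i by (simp add: rotate_drop_take Cons_nth_drop_Suc)
  also have "gap_summable \<dots>"
    using i pos by (intro gap_summable_leading) (auto dest: in_set_dropD in_set_takeD)
  finally have N: "gap_summable (rotate ?N ks)" .
  have "j \<le> ?N" using i by (cases "length ks") auto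
  then show ?thesis
    by (induction rule: inc_induct) (use N down in auto)
qed

theorem mainTheorem1:
  fixes ks :: "nat list"
  assumes "\<forall>k\<in>set ks. k \<ge> 1"
    and "\<exists>k\<in>set ks. k \<ge> 2"
  shows "(\<Sum>j<length ks. mzv ((ks ! j + 1) # drop (j + 1) ks @ take j ks))
    = (\<Sum>j\<in>{j. j < length ks \<and> ks ! j \<ge> 2}. \<Sum>q=0..ks ! j - 2.
         mzv ((ks ! j - q) # drop (j + 1) ks @ take j ks @ [q + 1]))"
proof -
  let ?l = "length ks"
  define L where "L j = mzv ((ks ! j + 1) # drop (j + 1) ks @ take j ks)" for j
  define R where "R j = (\<Sum>q<ks ! j - 1. mzv ((ks ! j - q) # drop (j + 1) ks @ take j ks @ [q + 1]))" for j
  define c where "c j = gap_sum (rotate j ks)" for j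
  have step: "L j - R j = c j - c (Suc j)" if j: "j < ?l" for j
  proof -
    define r where "r = drop (j + 1) ks @ take j ks"
    have rot: "rotate j ks = ks ! j # r"
      using j by (simp add: rotate_drop_take Cons_nth_drop_Suc r_def)
    have p: "ks ! j \<ge> 1" "\<forall>k\<in>set r. k \<ge> 1"
      using assms(1) j by (auto simp: r_def dest: in_set_dropD in_set_takeD)
    have rot': "rotate (Suc j) ks = r @ [ks ! j]" using rot by simp
    have "gap_summable (r @ [ks ! j])"
      using gap_summable_any_rotation[OF assms, of "Suc j"] unfolding rot' .
    from gap_sum_rotate1(2)[OF p(1) this summable_on_mzv_term] p
    have "c j + R j = c (Suc j) + L j"
      unfolding c_def rot rot' R_def L_def by (simp add: r_def)
    then show ?thesis by simp
  qed
  have "(\<Sum>j<?l. L j) - (\<Sum>j<?l. R j) = (\<Sum>j<?l. c j - c (Suc j))"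
    by (simp add: sum_subtractf[symmetric] step)
  also have "\<dots> = c 0 - c ?l" by (rule sum_lessThan_telescope')
  also have "\<dots> = 0" by (simp add: c_def)
  finally have "(\<Sum>j<?l. L j) = (\<Sum>j<?l. R j)" by simp
  moreover have "R j = 0" if "\<not> 2 \<le> ks ! j" for j
  proof -
    have "ks ! j - 1 = 0" using that by simp
    then show ?thesis by (simp only: R_def) simp
  qed
  ultimately have "(\<Sum>j<?l. L j) = (\<Sum>j\<in>{j. j < ?l \<and> ks ! j \<ge> 2}. R j)"
    by (subst sum.mono_neutral_left[of "{..<?l}"]) auto
  also have "\<dots> = (\<Sum>j\<in>{j. j < ?l \<and> ks ! j \<ge> 2}. \<Sum>q=0..ks ! j - 2.
         mzv ((ks ! j - q) # drop (j + 1) ks @ take j ks @ [q + 1]))"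
    unfolding R_def by (intro sum.cong) auto
  finally show ?thesis by (simp add: L_def)
qed

end
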